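(* Let $n\ge 2$, let $K_1,\dots,K_n$ be convex sets in $\mathbb{R}^d$ and let $k\in[n]$. For $J\subseteq[n]$ let $K(J)=\bigcap_{j\in J}K_j$. If the closed Euclidean unit ball $B(b,1)$ centred at some $b\in\mathbb{R}^d$ intersects $K(J)$ for every $J\subseteq[n]$ with $|J|=k$, then there is a point $q\in\mathbb{R}^d$ such that \[ d(q,K_i)\le\sqrt{\frac{n-k}{k(n-1)}}\qquad\text{for all } i\in[n]. \]
   Context: $B(b,1)$ is the closed Euclidean ball of centre $b$ and radius $1$; $d(q,K)$ is the Euclidean distance from a point to a set; $[n]=\{1,\dots,n\}$. *)

theory Defs
  imports "HOL-Analysis.Analysis"
begin

end

theory Submission
  imports Defs
begin

text \<open>
  Choose \<open>x\<^sub>J\<close> in the ball and in \<open>K(J)\<close>, shrink \<open>K\<^sub>i\<close> to the hull of the \<open>x\<^sub>J\<close> with \<open>i \<in> J\<close>, and let \<open>q\<close>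
  minimise the largest distance \<open>r\<close> to these sets. The unit normals \<open>u\<^sub>i\<close> at the sets attaining \<open>r\<close> have
  \<open>0\<close> in their convex hull, and every \<open>w\<close> in the hull of \<open>{u\<^sub>i : i \<in> J}\<close> satisfies
  \<open>r \<le> w \<bullet> (x\<^sub>J - q) \<le> |w| + w \<bullet> (b - q)\<close>. With \<open>\<rho>\<close> the claimed bound, it remains to find \<open>J\<close> and \<open>w\<close>
  whose distance from \<open>p = -\<rho>(b - q)\<close> is at most \<open>\<surd>(|p|\<^sup>2 + \<rho>\<^sup>2)\<close>.

  Vertices are removed one at a time: if \<open>w\<close> lies in a simplex with \<open>m + 1\<close> vertices inside the unit ball,
  then for every point \<open>q\<close> some facet contains a point \<open>w'\<close> with
  \<open>|w' - q|\<^sup>2 \<le> |w - q|\<^sup>2 + (1 - |w|\<^sup>2) / m\<^sup>2\<close>. This is a form of Euler's inequality between inradius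
  and circumradius. To prove it, pair each vertex with the unit normal of the opposite facet through
  the Lorentz boost of velocity \<open>w\<close>: each pairing is nonnegative, being a product of two future-directed
  causal vectors, and their weighted sum is computed from the identity \<open>\<Sum>v. x\<^sub>v g\<^sub>v\<^sup>T = I\<close> for the gradients
  \<open>g\<^sub>v\<close> of the barycentric coordinates.
\<close>

section \<open>A Lorentz boost and an inequality of Euler type\<close>

text \<open>The vector on the left and \<open>t + w \<bullet> n\<close> are the space and time parts
  of the boost of the causal vector \<open>(t, n)\<close> with velocity \<open>w\<close>, multiplied
  by \<open>\<nu>\<close>, the reciprocal of the Lorentz factor, so that \<open>norm w = 1\<close>
  is allowed. A boost preserves the Minkowski form, so the squares of the two sides differ by
  \<open>\<nu>\<^sup>2 * (t\<^sup>2 - n \<bullet> n)\<close>.\<close>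

lemma norm_velocity_addition_le:
  fixes w n :: "'a::real_inner"
  assumes w: "norm w \<le> 1" and n: "norm n \<le> t"
  defines "\<nu> \<equiv> sqrt (1 - (norm w)\<^sup>2)"
  shows "norm (t *\<^sub>R w + \<nu> *\<^sub>R n + ((w \<bullet> n) / (1 + \<nu>)) *\<^sub>R w) \<le> t + w \<bullet> n"
proof -
  have w2: "(norm w)\<^sup>2 \<le> 1" using w by (simp add: power_le_one)
  have \<nu>: "\<nu> \<ge> 0" "\<nu>\<^sup>2 = 1 - w \<bullet> w"
    using w2 unfolding \<nu>_def by (auto simp: dot_square_norm)
  have t: "t \<ge> 0" using n norm_ge_zero order_trans by blast
  have "\<bar>w \<bullet> n\<bar> \<le> norm w * norm n" by (rule Cauchy_Schwarz_ineq2)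
  also have "\<dots> \<le> 1 * t" by (intro mult_mono w n) auto
  finally have pos: "t + w \<bullet> n \<ge> 0" by simp
  have nt: "n \<bullet> n \<le> t\<^sup>2"
    using n power_mono[OF n, of 2] by (simp add: dot_square_norm)
  define c where "c = w \<bullet> n"
  define d where "d = c / (1 + \<nu>)"
  have c: "c = d * (1 + \<nu>)" using \<nu> by (simp add: d_def)
  have ww: "w \<bullet> w = (1 - \<nu>) * (1 + \<nu>)" using \<nu>(2) by (simp add: algebra_simps power2_eq_square)
  have nw: "n \<bullet> w = c" by (simp add: c_def inner_commute)
  have "(norm (t *\<^sub>R w + \<nu> *\<^sub>R n + d *\<^sub>R w))\<^sup>2
      = (t + d)\<^sup>2 * (w \<bullet> w) + 2 * \<nu> * (t + d) * c + \<nu>\<^sup>2 * (n \<bullet> n)"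
    unfolding power2_norm_eq_inner
    by (simp add: inner_add nw c_def[symmetric] algebra_simps power2_eq_square)
  also have "\<dots> \<le> (t + d)\<^sup>2 * (w \<bullet> w) + 2 * \<nu> * (t + d) * c + \<nu>\<^sup>2 * t\<^sup>2"
    using nt by (simp add: mult_left_mono)
  also have "\<dots> = (t + c)\<^sup>2"
    unfolding ww c by (simp add: power2_eq_square algebra_simps)
  finally show ?thesis
    using pos power2_le_imp_le unfolding c_def d_def by blast
qed

text \<open>Here \<open>\<alpha>\<close>, \<open>\<omega>\<close>, \<open>\<pi>\<close> are
  barycentric coordinates of \<open>w\<close>, of the origin and of \<open>q\<close>, and
  \<open>g v\<close> stands for the gradient of the coordinate at \<open>v\<close>, so that
  \<open>\<pi> v / norm (g v)\<close> is the distance from \<open>q\<close> to the hyperplane of the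
  facet opposite to \<open>v\<close>. For \<open>w = q = 0\<close> the bound reads
  \<open>m * \<delta> \<le> 1\<close>, Euler's inequality for concentric balls.\<close>

lemma inradius_bound_core:
  fixes x g :: "'i \<Rightarrow> 'a::real_inner" and \<alpha> \<omega> \<pi> :: "'i \<Rightarrow> real"
  assumes V: "finite V" "card V = m + 1"
    and x: "\<And>v. v \<in> V \<Longrightarrow> norm (x v) \<le> 1"
    and sums: "sum \<alpha> V = 1" "sum \<omega> V = 1" "sum \<pi> V = 1"
    and o: "(\<Sum>v\<in>V. \<omega> v *\<^sub>R x v) = 0"
    and w: "(\<Sum>v\<in>V. \<alpha> v *\<^sub>R x v) = w" "norm w \<le> 1"
    and q: "(\<Sum>v\<in>V. \<pi> v *\<^sub>R x v) = q"
    and gx: "\<And>v. v \<in> V \<Longrightarrow> g v \<bullet> x v = 1 - \<omega> v"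
    and gw: "\<And>v. v \<in> V \<Longrightarrow> g v \<bullet> w = \<alpha> v - \<omega> v"
    and \<delta>: "\<delta> \<ge> 0" "\<And>v. v \<in> V \<Longrightarrow> \<delta> * norm (g v) \<le> \<pi> v"
    and m: "m \<ge> 1"
  shows "(real m)\<^sup>2 * \<delta>\<^sup>2 \<le> (real m)\<^sup>2 * (norm (w - q))\<^sup>2 + (1 - (norm w)\<^sup>2)"
proof -
  define \<nu> where "\<nu> = sqrt (1 - (norm w)\<^sup>2)"
  have w2: "(norm w)\<^sup>2 \<le> 1" using w by (simp add: power_le_one)
  have \<nu>: "\<nu> \<ge> 0" "\<nu>\<^sup>2 = 1 - (norm w)\<^sup>2" "\<nu> \<le> 1"
    using w2 unfolding \<nu>_def by auto
  have ww: "w \<bullet> w = (1 - \<nu>) * (1 + \<nu>)"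
    using \<nu>(2) by (simp add: algebra_simps power2_eq_square dot_square_norm)
  \<comment> \<open>The matrix \<open>\<Sum>v. x v g v\<^sup>T\<close> is the identity on the directions of the simplex; the last two
    summands are its pairings with \<open>\<nu> I\<close> and \<open>w w\<^sup>T / (1 + \<nu>)\<close>, so the sum over \<open>v\<close> is explicit.\<close>
  have vertex: "\<pi> v * (x v \<bullet> w) + \<nu> * \<delta> * (1 - \<omega> v) + \<delta> / (1 + \<nu>) * ((\<alpha> v - \<omega> v) * (x v \<bullet> w))
      \<le> \<pi> v + \<delta> * (\<alpha> v - \<omega> v)" if v: "v \<in> V" for v
  proof -
    define n where "n = \<delta> *\<^sub>R g v"
    have n: "norm n \<le> \<pi> v" using \<delta> v by (simp add: n_def)
    have wn: "w \<bullet> n = \<delta> * (\<alpha> v - \<omega> v)" using gw[OF v] by (simp add: n_def inner_commute)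
    have xn: "x v \<bullet> n = \<delta> * (1 - \<omega> v)" using gx[OF v] by (simp add: n_def inner_commute)
    let ?z = "\<pi> v *\<^sub>R w + \<nu> *\<^sub>R n + ((w \<bullet> n) / (1 + \<nu>)) *\<^sub>R w"
    have "x v \<bullet> ?z \<le> norm (x v) * norm ?z" by (rule norm_cauchy_schwarz)
    also have "\<dots> \<le> 1 * (\<pi> v + w \<bullet> n)"
      using norm_velocity_addition_le[OF w(2) n] x[OF v]
      by (intro mult_mono) (auto simp: \<nu>_def)
    also have "x v \<bullet> ?z = \<pi> v * (x v \<bullet> w) + \<nu> * \<delta> * (1 - \<omega> v)
        + \<delta> / (1 + \<nu>) * ((\<alpha> v - \<omega> v) * (x v \<bullet> w))"
      by (simp add: inner_add wn xn)
    finally show ?thesis by (simp add: wn)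
  qed
  have "(\<Sum>v\<in>V. \<pi> v * (x v \<bullet> w) + \<nu> * \<delta> * (1 - \<omega> v)
          + \<delta> / (1 + \<nu>) * ((\<alpha> v - \<omega> v) * (x v \<bullet> w)))
      \<le> (\<Sum>v\<in>V. \<pi> v + \<delta> * (\<alpha> v - \<omega> v))"
    by (rule sum_mono) (rule vertex)
  moreover have "(\<Sum>v\<in>V. \<pi> v * (x v \<bullet> w)) = q \<bullet> w"
    unfolding q[symmetric] by (simp add: inner_sum_left)
  moreover have "(\<Sum>v\<in>V. (1 - \<omega> v)) = m" using V sums by (simp add: sum_subtractf)
  moreover have "(\<Sum>v\<in>V. (\<alpha> v - \<omega> v) * (x v \<bullet> w)) = w \<bullet> w"
  proof -
    have "(\<Sum>v\<in>V. (\<alpha> v - \<omega> v) * (x v \<bullet> w))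
        = ((\<Sum>v\<in>V. \<alpha> v *\<^sub>R x v) - (\<Sum>v\<in>V. \<omega> v *\<^sub>R x v)) \<bullet> w"
      by (simp add: inner_diff_left inner_sum_left left_diff_distrib sum_subtractf)
    then show ?thesis by (simp add: o w)
  qed
  moreover have "(\<Sum>v\<in>V. \<pi> v + \<delta> * (\<alpha> v - \<omega> v)) = 1"
    using sums by (simp add: sum.distrib sum_subtractf flip: sum_distrib_left)
  ultimately have summed: "q \<bullet> w + \<nu> * \<delta> * m + \<delta> / (1 + \<nu>) * (w \<bullet> w) \<le> 1"
    by (simp only: sum.distrib flip: sum_distrib_left)
  \<comment> \<open>The coefficient of \<open>\<delta>\<close> collects \<open>m * \<nu>\<close>
    from the identity matrix and \<open>1 - \<nu>\<close> from the rank-one term.\<close>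
  have main: "\<delta> * (1 + (real m - 1) * \<nu>) \<le> 1 - q \<bullet> w"
  proof -
    have "\<delta> / (1 + \<nu>) * (w \<bullet> w) = \<delta> * (1 - \<nu>)" using \<nu>(1) unfolding ww by simp
    then show ?thesis using summed by (simp add: algebra_simps)
  qed
  define D where "D = (real m)\<^sup>2 * (norm (w - q))\<^sup>2 + \<nu>\<^sup>2"
  define E where "E = 1 + (real m - 1) * \<nu>"
  have E: "E > 0" unfolding E_def using m \<nu> by (simp add: add_pos_nonneg)
  have "1 - q \<bullet> w = \<nu>\<^sup>2 + (w - q) \<bullet> w"
    using \<nu> by (simp add: inner_diff_left dot_square_norm)
  also have "\<dots> \<le> \<nu>\<^sup>2 + norm (w - q) * norm w"
    using norm_cauchy_schwarz[of "w - q" w] by simp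
  finally have "m * (\<delta> * E) \<le> m * (\<nu>\<^sup>2 + norm (w - q) * norm w)"
    using main unfolding E_def by (intro mult_left_mono) auto
  then have "(m * (\<delta> * E))\<^sup>2 \<le> (m * (\<nu>\<^sup>2 + norm (w - q) * norm w))\<^sup>2"
    using \<delta>(1) E by (intro power_mono) auto
  \<comment> \<open>Cauchy-Schwarz in the plane for \<open>(m * norm (w - q), \<nu>)\<close> and
    \<open>(norm w, m * \<nu>)\<close>; the square below is the defect in Lagrange's
    identity.\<close>
  also have "\<dots> \<le> D * ((real m)\<^sup>2 * \<nu>\<^sup>2 + (norm w)\<^sup>2)"
  proof -
    have "D * ((real m)\<^sup>2 * \<nu>\<^sup>2 + (norm w)\<^sup>2) - (m * (\<nu>\<^sup>2 + norm (w - q) * norm w))\<^sup>2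
        = (\<nu> * norm w - (real m)\<^sup>2 * norm (w - q) * \<nu>)\<^sup>2"
      unfolding D_def by (simp add: power2_eq_square algebra_simps)
    then show ?thesis by (metis diff_ge_0_iff_ge zero_le_power2)
  qed
  also have "\<dots> \<le> D * E\<^sup>2"
  proof (rule mult_left_mono)
    have "E\<^sup>2 - ((real m)\<^sup>2 * \<nu>\<^sup>2 + (norm w)\<^sup>2) = 2 * (real m - 1) * (\<nu> * (1 - \<nu>))"
      using \<nu>(2) unfolding E_def by (simp add: power2_eq_square algebra_simps)
    also have "\<dots> \<ge> 0" using m \<nu> by simp
    finally show "(real m)\<^sup>2 * \<nu>\<^sup>2 + (norm w)\<^sup>2 \<le> E\<^sup>2" by simp
  qed (simp add: D_def)
  finally have "((real m)\<^sup>2 * \<delta>\<^sup>2) * E\<^sup>2 \<le> D * E\<^sup>2" by (simp add: power_mult_distrib mult_ac)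
  then have "(real m)\<^sup>2 * \<delta>\<^sup>2 \<le> D" using E by simp
  then show ?thesis by (simp add: D_def \<nu>(2))
qed

section \<open>Barycentric gradients and the nearest facet\<close>

text \<open>The mirror image of \<open>x\<close> in the foot of the perpendicular also lies in
  \<open>A\<close>, so the variational inequality of the closest point holds with both
  signs.\<close>

lemma closest_point_affine_orthogonal:
  fixes A :: "'a::euclidean_space set"
  assumes "affine A" "closed A" "x \<in> A"
  shows "(y - closest_point A y) \<bullet> (x - closest_point A y) = 0"
proof -
  let ?a = "closest_point A y"
  have cv: "convex A" using assms(1) by (rule affine_imp_convex)
  have a: "?a \<in> A" using assms closest_point_in_set by blast
  have "2 *\<^sub>R ?a + (-1) *\<^sub>R x \<in> A"
    using assms a by (intro mem_affine) auto
  then have "(y - ?a) \<bullet> (2 *\<^sub>R ?a + (-1) *\<^sub>R x - ?a) \<le> 0"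
    by (intro closest_point_dot cv assms)
  moreover have "(y - ?a) \<bullet> (x - ?a) \<le> 0" by (intro closest_point_dot cv assms)
  moreover have "2 *\<^sub>R ?a + (-1) *\<^sub>R x - ?a = - (x - ?a)" by (simp add: scaleR_2)
  ultimately show ?thesis by (metis inner_minus_right neg_le_0_iff_le order_antisym)
qed

text \<open>The gradient is the altitude at \<open>v\<close> divided by its squared length. The
  clause with \<open>c\<close> makes \<open>g\<close> parallel to the affine hull of
  \<open>V\<close>, so that moving along \<open>g\<close> does not leave it.\<close>

lemma barycentric_gradient_exists:
  fixes V :: "'a::euclidean_space set"
  assumes V: "finite V" "\<not> affine_dependent V" "v \<in> V" "card V \<ge> 2"
  shows "\<exists>g. g \<noteq> 0 \<and> (\<exists>c. sum c V = 0 \<and> g = (\<Sum>x\<in>V. c x *\<^sub>R x)) \<and>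
      (\<forall>d. sum d V = 0 \<longrightarrow> g \<bullet> (\<Sum>x\<in>V. d x *\<^sub>R x) = d v)"
proof -
  define A where "A = affine hull (V - {v})"
  have ne: "V - {v} \<noteq> {}"
  proof
    assume "V - {v} = {}"
    then have "V = {v}" using V(3) by blast
    then show False using V(4) by simp
  qed
  have A: "affine A" "closed A" "A \<noteq> {}" unfolding A_def using ne by auto
  have vA: "v \<notin> A" using V unfolding affine_dependent_def A_def by blast
  define a where "a = closest_point A v"
  have aA: "a \<in> A" unfolding a_def using A by (simp add: closest_point_in_set)
  define N where "N = (norm (v - a))\<^sup>2"
  have N: "N > 0" using vA aA unfolding N_def by auto
  define g where "g = (1 / N) *\<^sub>R (v - a)"
  have gv: "g \<bullet> x = g \<bullet> v - 1" if "x \<in> V - {v}" for x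
  proof -
    have "x \<in> A" unfolding A_def using that by (simp add: hull_inc)
    then have "(v - a) \<bullet> (x - a) = 0"
      unfolding a_def by (intro closest_point_affine_orthogonal A)
    then have "(v - a) \<bullet> (v - x) = N"
      unfolding N_def power2_norm_eq_inner by (simp add: inner_diff_right)
    then have "g \<bullet> (v - x) = 1" using N by (simp add: g_def)
    then show ?thesis by (simp add: inner_diff_right)
  qed
  obtain e where e: "sum e (V - {v}) = 1" "(\<Sum>x\<in>V - {v}. e x *\<^sub>R x) = a"
    using aA V(1) unfolding A_def by (subst (asm) affine_hull_finite) auto
  define c where "c = (\<lambda>x. (if x = v then 1 else - e x) / N)"
  have "sum c V = c v + sum c (V - {v})" using V by (simp add: sum.remove)
  also have "sum c (V - {v}) = (\<Sum>x\<in>V - {v}. - e x / N)"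
    by (rule sum.cong) (auto simp: c_def)
  also have "\<dots> = - 1 / N" using e by (simp add: sum_negf flip: sum_divide_distrib)
  finally have c1: "sum c V = 0" by (simp add: c_def)
  have "(\<Sum>x\<in>V. c x *\<^sub>R x) = c v *\<^sub>R v + (\<Sum>x\<in>V - {v}. c x *\<^sub>R x)"
    using V by (simp add: sum.remove)
  also have "(\<Sum>x\<in>V - {v}. c x *\<^sub>R x) = (\<Sum>x\<in>V - {v}. (- 1 / N) *\<^sub>R (e x *\<^sub>R x))"
    by (rule sum.cong) (auto simp: c_def)
  also have "\<dots> = (- 1 / N) *\<^sub>R a" by (simp only: e flip: scaleR_sum_right)
  finally have c2: "g = (\<Sum>x\<in>V. c x *\<^sub>R x)"
    by (simp add: c_def g_def scaleR_diff_right)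
  have c3: "g \<bullet> (\<Sum>x\<in>V. d x *\<^sub>R x) = d v" if d: "sum d V = 0" for d
  proof -
    have dv: "sum d (V - {v}) = - d v" using d V by (simp add: sum.remove)
    have "g \<bullet> (\<Sum>x\<in>V. d x *\<^sub>R x) = (\<Sum>x\<in>V. d x * (g \<bullet> x))" by (simp add: inner_sum_right)
    also have "\<dots> = d v * (g \<bullet> v) + (\<Sum>x\<in>V - {v}. d x * (g \<bullet> x))" using V by (simp add: sum.remove)
    also have "(\<Sum>x\<in>V - {v}. d x * (g \<bullet> x)) = (\<Sum>x\<in>V - {v}. d x * (g \<bullet> v - 1))"
      by (rule sum.cong) (auto simp: gv)
    also have "\<dots> = - d v * (g \<bullet> v - 1)" by (simp add: dv flip: sum_distrib_right)
    finally show ?thesis by (simp add: algebra_simps)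
  qed
  have "g \<noteq> 0" using N vA aA by (auto simp: g_def)
  then show ?thesis using c1 c2 c3 by blast
qed

text \<open>For \<open>q\<close> inside the simplex, \<open>w'\<close> is the foot of the
  perpendicular from \<open>q\<close> to the nearest facet hyperplane;
  \<open>inradius_bound_core\<close> bounds its length.\<close>

lemma affine_independent_ball_near_facet:
  fixes V :: "'a::euclidean_space set"
  assumes V: "finite V" "\<not> affine_dependent V" "card V = m + 1" "m \<ge> 1" "V \<subseteq> cball 0 1"
    and w: "w \<in> convex hull V" and q: "q \<in> convex hull V"
  shows "\<exists>v\<in>V. \<exists>w'\<in>convex hull (V - {v}).
    (norm (w' - q))\<^sup>2 \<le> (norm (w - q))\<^sup>2 + (1 - (norm w)\<^sup>2) / (real m)\<^sup>2"
proof -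
  have "\<forall>v\<in>V. \<exists>g. g \<noteq> 0 \<and> (\<exists>c. sum c V = 0 \<and> g = (\<Sum>x\<in>V. c x *\<^sub>R x)) \<and>
      (\<forall>d. sum d V = 0 \<longrightarrow> g \<bullet> (\<Sum>x\<in>V. d x *\<^sub>R x) = d v)"
  proof
    fix v assume v: "v \<in> V"
    have "card V \<ge> 2" using V by simp
    from barycentric_gradient_exists[OF V(1,2) v this]
    show "\<exists>g. g \<noteq> 0 \<and> (\<exists>c. sum c V = 0 \<and> g = (\<Sum>x\<in>V. c x *\<^sub>R x)) \<and>
      (\<forall>d. sum d V = 0 \<longrightarrow> g \<bullet> (\<Sum>x\<in>V. d x *\<^sub>R x) = d v)" .
  qed
  then obtain g where g: "\<forall>v\<in>V. g v \<noteq> 0 \<and> (\<exists>c. sum c V = 0 \<and> g v = (\<Sum>x\<in>V. c x *\<^sub>R x)) \<and>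
      (\<forall>d. sum d V = 0 \<longrightarrow> g v \<bullet> (\<Sum>x\<in>V. d x *\<^sub>R x) = d v)"
    by (rule bchoice[THEN exE])
  have g0: "g v \<noteq> 0" if "v \<in> V" for v using g that by blast
  have gd: "g v \<bullet> (\<Sum>x\<in>V. d x *\<^sub>R x) = d v" if "v \<in> V" "sum d V = 0" for v d using g that by blast
  obtain \<pi> where \<pi>: "\<And>v. v \<in> V \<Longrightarrow> \<pi> v \<ge> 0" "sum \<pi> V = 1" "(\<Sum>v\<in>V. \<pi> v *\<^sub>R v) = q"
    using q V(1) by (auto simp: convex_hull_finite)
  obtain \<alpha> where \<alpha>: "\<And>v. v \<in> V \<Longrightarrow> \<alpha> v \<ge> 0" "sum \<alpha> V = 1" "(\<Sum>v\<in>V. \<alpha> v *\<^sub>R v) = w"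
    using w V(1) by (auto simp: convex_hull_finite)
  have Vne: "V \<noteq> {}" using V by auto
  define A where "A = affine hull V"
  have A: "affine A" "closed A" "A \<noteq> {}" unfolding A_def using Vne by auto
  \<comment> \<open>The core estimate needs the origin in the affine hull. The hull cuts the unit
    ball in a ball with centre \<open>z\<close> and radius \<open>R\<close>, which is then moved and
    scaled to the unit ball about 0.\<close>
  define z where "z = closest_point A 0"
  have zA: "z \<in> A" unfolding z_def using A by (simp add: closest_point_in_set)
  obtain \<omega> where \<omega>: "sum \<omega> V = 1" "(\<Sum>v\<in>V. \<omega> v *\<^sub>R v) = z"
    using zA V(1) unfolding A_def by (subst (asm) affine_hull_finite) auto
  have pyth: "(norm (x - z))\<^sup>2 = (norm x)\<^sup>2 - (norm z)\<^sup>2" if "x \<in> A" for x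
  proof -
    have "(0 - z) \<bullet> (x - z) = 0"
      using that unfolding z_def by (intro closest_point_affine_orthogonal A)
    then have "x \<bullet> z = z \<bullet> z" by (simp add: inner_diff_right inner_commute)
    then show ?thesis by (simp add: power2_norm_eq_inner inner_diff inner_commute)
  qed
  have VA: "V \<subseteq> A" unfolding A_def by (rule hull_subset)
  have hA: "convex hull V \<subseteq> A" unfolding A_def by (rule convex_hull_subset_affine_hull)
  define R where "R = sqrt (1 - (norm z)\<^sup>2)"
  have le: "(norm (x - z))\<^sup>2 \<le> 1 - (norm z)\<^sup>2" if "x \<in> A" "norm x \<le> 1" for x
    using pyth[OF that(1)] power_le_one[OF norm_ge_zero that(2), of 2] by simp
  have "1 - (norm z)\<^sup>2 > 0"
  proof -
    have "\<exists>v\<in>V. v \<noteq> z"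
    proof (rule ccontr)
      assume "\<not> ?thesis"
      then have "V \<subseteq> {z}" by blast
      then have "card V \<le> 1" using card_mono[of "{z}" V] by simp
      then show False using V by simp
    qed
    then obtain v where "v \<in> V" "v \<noteq> z" by blast
    then have "0 < (norm (v - z))\<^sup>2" by simp
    also have "\<dots> \<le> 1 - (norm z)\<^sup>2" using \<open>v \<in> V\<close> V VA by (intro le) auto
    finally show ?thesis .
  qed
  then have R: "R > 0" "R\<^sup>2 = 1 - (norm z)\<^sup>2" by (auto simp: R_def)
  have leR: "norm (x - z) \<le> R" if "x \<in> A" "norm x \<le> 1" for x
    using le[OF that] R by (simp add: R_def real_le_rsqrt)
  have w1: "norm w \<le> 1"
    using w V(5) hull_minimal[of V "cball 0 1" convex] by (auto simp: subset_iff)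
  define \<delta> where "\<delta> = Min ((\<lambda>v. \<pi> v / norm (g v)) ` V)"
  obtain v where v: "v \<in> V" "\<delta> = \<pi> v / norm (g v)"
  proof -
    have "\<delta> \<in> (\<lambda>v. \<pi> v / norm (g v)) ` V"
      unfolding \<delta>_def using V(1) Vne by (intro Min_in) auto
    then show thesis using that by blast
  qed
  obtain c where c: "sum c V = 0" "g v = (\<Sum>x\<in>V. c x *\<^sub>R x)" using g v(1) by blast
  have \<delta>le: "\<delta> * norm (g x) \<le> \<pi> x" if "x \<in> V" for x
  proof -
    have "\<delta> \<le> \<pi> x / norm (g x)" unfolding \<delta>_def using V(1) that by simp
    then show ?thesis using g0[OF that] by (simp add: pos_le_divide_eq)
  qed
  have \<delta>0: "\<delta> \<ge> 0" using v \<pi> by simp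
  \<comment> \<open>Moving along \<open>g v\<close> thus changes the coordinate at \<open>x\<close>
    at the rate \<open>c x\<close>, which Cauchy-Schwarz controls.\<close>
  have gV: "g v \<bullet> g x = c x" if "x \<in> V" for x
    using gd[OF that c(1)] c(2) by (simp add: inner_commute)
  \<comment> \<open>As \<open>\<pi> x / norm (g x)\<close> is the distance from \<open>q\<close> to the hyperplane of the facet opposite to \<open>x\<close>,
    the foot \<open>w'\<close> of the perpendicular to the nearest hyperplane stays inside the simplex.\<close>
  define s where "s = \<pi> v / (norm (g v))\<^sup>2"
  define w' where "w' = q - s *\<^sub>R g v"
  define \<beta> where "\<beta> = (\<lambda>x. \<pi> x - s * c x)"
  have s0: "s \<ge> 0" using v \<pi> by (simp add: s_def)
  have \<beta>v: "\<beta> v = 0"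
    using g0[OF v(1)] by (simp add: \<beta>_def s_def power2_norm_eq_inner flip: gV[OF v(1)])
  have \<beta>0: "\<beta> x \<ge> 0" if "x \<in> V" for x
  proof -
    have "s * c x \<le> s * (norm (g v) * norm (g x))"
      using norm_cauchy_schwarz[of "g v" "g x"] gV[OF that] s0 by (intro mult_left_mono) auto
    also have "\<dots> = \<delta> * norm (g x)"
      using g0[OF v(1)] by (simp add: s_def v(2) power2_eq_square)
    also have "\<dots> \<le> \<pi> x" by (rule \<delta>le[OF that])
    finally show ?thesis by (simp add: \<beta>_def)
  qed
  have \<beta>1: "sum \<beta> V = 1"
    using \<pi> c(1) by (simp add: \<beta>_def sum_subtractf flip: sum_distrib_left)
  have "(\<Sum>x\<in>V. \<beta> x *\<^sub>R x) = (\<Sum>x\<in>V. \<pi> x *\<^sub>R x) - s *\<^sub>R (\<Sum>x\<in>V. c x *\<^sub>R x)"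
    by (simp add: \<beta>_def scaleR_diff_left sum_subtractf scaleR_sum_right)
  then have \<beta>2: "(\<Sum>x\<in>V. \<beta> x *\<^sub>R x) = w'"
    using \<pi>(3) c(2) by (simp add: w'_def)
  have w': "w' \<in> convex hull (V - {v})"
  proof -
    have "sum \<beta> (V - {v}) = 1" "(\<Sum>x\<in>V - {v}. \<beta> x *\<^sub>R x) = w'"
      using \<beta>1 \<beta>2 \<beta>v V(1) v(1) by (simp_all add: sum.remove)
    moreover have "\<forall>x\<in>V - {v}. 0 \<le> \<beta> x" using \<beta>0 by blast
    ultimately show ?thesis using V(1) by (subst convex_hull_finite) auto
  qed
  have nw': "norm (w' - q) = \<delta>"
    using g0[OF v(1)] \<pi>(1)[OF v(1)] by (simp add: w'_def v(2) s_def power2_eq_square)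
  have shift: "(\<Sum>v\<in>V. \<phi> v *\<^sub>R ((1 / R) *\<^sub>R (v - z))) = (1 / R) *\<^sub>R (y - z)"
    if "sum \<phi> V = 1" "(\<Sum>v\<in>V. \<phi> v *\<^sub>R v) = y" for \<phi> y
  proof -
    have "(\<Sum>v\<in>V. \<phi> v *\<^sub>R ((1 / R) *\<^sub>R (v - z))) = (1 / R) *\<^sub>R (\<Sum>v\<in>V. \<phi> v *\<^sub>R (v - z))"
      by (simp add: scaleR_sum_right mult.commute)
    also have "(\<Sum>v\<in>V. \<phi> v *\<^sub>R (v - z)) = y - z"
      using that by (simp add: scaleR_diff_right sum_subtractf flip: scaleR_sum_left)
    finally show ?thesis .
  qed
  have gdiff: "g v \<bullet> (y - z) = \<phi> v - \<omega> v"
    if "v \<in> V" "sum \<phi> V = 1" "(\<Sum>v\<in>V. \<phi> v *\<^sub>R v) = y" for \<phi> y v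
    using gd[OF that(1), of "\<lambda>v. \<phi> v - \<omega> v"] that \<omega>
    by (simp add: sum_subtractf scaleR_diff_left)
  have gvert: "g v \<bullet> (v - z) = 1 - \<omega> v" if "v \<in> V" for v
  proof -
    have "(\<Sum>x\<in>V. (if x = v then 1 else 0) *\<^sub>R x) = v"
      using that V(1) by (simp add: if_distrib[of "\<lambda>t. t *\<^sub>R _"] cong: if_cong)
    from gdiff[OF that _ this] that V(1) show ?thesis by simp
  qed
  \<comment> \<open>Scaling points by \<open>1 / R\<close> multiplies gradients by \<open>R\<close>
    and keeps barycentric coordinates.\<close>
  have "(real m)\<^sup>2 * (\<delta> / R)\<^sup>2 \<le> (real m)\<^sup>2 * (norm ((1 / R) *\<^sub>R (w - z) - (1 / R) *\<^sub>R (q - z)))\<^sup>2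
      + (1 - (norm ((1 / R) *\<^sub>R (w - z)))\<^sup>2)"
  proof (rule inradius_bound_core[where g = "\<lambda>v. R *\<^sub>R g v" and x = "\<lambda>v. (1 / R) *\<^sub>R (v - z)"])
    show "finite V" "card V = m + 1" "1 \<le> m" by fact+
    show "sum \<alpha> V = 1" "sum \<omega> V = 1" "sum \<pi> V = 1" by fact+
    show "norm ((1 / R) *\<^sub>R (v - z)) \<le> 1" if "v \<in> V" for v
      using leR[of v] that VA V(5) R by (auto simp: subset_iff)
    show "(\<Sum>v\<in>V. \<omega> v *\<^sub>R ((1 / R) *\<^sub>R (v - z))) = 0" using shift[OF \<omega>] by simp
    show "(\<Sum>v\<in>V. \<alpha> v *\<^sub>R ((1 / R) *\<^sub>R (v - z))) = (1 / R) *\<^sub>R (w - z)" by (rule shift[OF \<alpha>(2,3)])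
    show "(\<Sum>v\<in>V. \<pi> v *\<^sub>R ((1 / R) *\<^sub>R (v - z))) = (1 / R) *\<^sub>R (q - z)" by (rule shift[OF \<pi>(2,3)])
    show "norm ((1 / R) *\<^sub>R (w - z)) \<le> 1" using leR[of w] w hA w1 R by auto
    show "R *\<^sub>R g v \<bullet> (1 / R) *\<^sub>R (v - z) = 1 - \<omega> v" if "v \<in> V" for v
      using gvert[OF that] R by simp
    show "R *\<^sub>R g v \<bullet> (1 / R) *\<^sub>R (w - z) = \<alpha> v - \<omega> v" if "v \<in> V" for v
      using gdiff[OF that \<alpha>(2,3)] R by simp
    show "0 \<le> \<delta> / R" using \<delta>0 R by simp
    show "\<delta> / R * norm (R *\<^sub>R g v) \<le> \<pi> v" if "v \<in> V" for v
      using \<delta>le[OF that] R by simp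
  qed
  also have "(1 / R) *\<^sub>R (w - z) - (1 / R) *\<^sub>R (q - z) = (1 / R) *\<^sub>R (w - q)"
    by (simp flip: scaleR_diff_right)
  finally have "((real m)\<^sup>2 * \<delta>\<^sup>2) / R\<^sup>2 \<le>
      ((real m)\<^sup>2 * (norm (w - q))\<^sup>2 + (R\<^sup>2 - (norm (w - z))\<^sup>2)) / R\<^sup>2"
    using R by (simp add: power_divide add_divide_distrib diff_divide_distrib)
  then have "(real m)\<^sup>2 * \<delta>\<^sup>2 \<le> (real m)\<^sup>2 * (norm (w - q))\<^sup>2 + (R\<^sup>2 - (norm (w - z))\<^sup>2)"
    using R(1) by (subst (asm) divide_le_cancel) auto
  also have "R\<^sup>2 - (norm (w - z))\<^sup>2 = 1 - (norm w)\<^sup>2"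
    using pyth[of w] w hA R by auto
  finally have "\<delta>\<^sup>2 \<le> (norm (w - q))\<^sup>2 + (1 - (norm w)\<^sup>2) / (real m)\<^sup>2"
    using V(4) by (simp add: field_simps)
  then show ?thesis using v(1) w' nw' by auto
qed

section \<open>Removing vertices one at a time\<close>

text \<open>Project \<open>q\<close> to the point \<open>p\<close> of the simplex. If
  \<open>p\<close> lies on a facet, it serves as \<open>w'\<close>. Otherwise \<open>q - p\<close>
  is orthogonal to the simplex, and replacing \<open>p\<close> by \<open>q\<close> adds the same
  constant to all squared distances.\<close>

lemma affine_independent_ball_step:
  fixes V :: "'a::euclidean_space set"
  assumes V: "finite V" "\<not> affine_dependent V" "card V = m + 1" "m \<ge> 1" "V \<subseteq> cball 0 1"
    and w: "w \<in> convex hull V"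
  shows "\<exists>v\<in>V. \<exists>w'\<in>convex hull (V - {v}).
    (norm (w' - q))\<^sup>2 \<le> (norm (w - q))\<^sup>2 + (1 - (norm w)\<^sup>2) / (real m)\<^sup>2"
proof -
  let ?H = "convex hull V"
  have H: "closed ?H" "?H \<noteq> {}"
    using V(1) w by (auto simp: compact_imp_closed finite_imp_compact compact_convex_hull)
  define p where "p = closest_point ?H q"
  have p: "p \<in> ?H" unfolding p_def using H by (simp add: closest_point_in_set)
  have dot: "(q - p) \<bullet> (x - p) \<le> 0" if "x \<in> ?H" for x
    unfolding p_def by (intro closest_point_dot H that convex_convex_hull)
  have w1: "norm w \<le> 1"
    using w V(5) hull_minimal[of V "cball 0 1" convex] by (auto simp: subset_iff)
  have w2: "(1 - (norm w)\<^sup>2) / (real m)\<^sup>2 \<ge> 0"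
    using w1 by (simp add: power_le_one)
  obtain \<pi> where \<pi>: "\<And>v. v \<in> V \<Longrightarrow> \<pi> v \<ge> 0" "sum \<pi> V = 1" "(\<Sum>v\<in>V. \<pi> v *\<^sub>R v) = p"
    using p V(1) by (auto simp: convex_hull_finite)
  have expand: "(norm (x - q))\<^sup>2 = (norm (x - p))\<^sup>2 + (norm (p - q))\<^sup>2 - 2 * ((q - p) \<bullet> (x - p))" for x
    by (simp add: power2_norm_eq_inner inner_diff inner_commute)
  show ?thesis
  proof (cases "\<exists>v\<in>V. \<pi> v = 0")
    case True
    then obtain v where v: "v \<in> V" "\<pi> v = 0" by blast
    have "sum \<pi> (V - {v}) = 1" "(\<Sum>x\<in>V - {v}. \<pi> x *\<^sub>R x) = p"
      using \<pi> v V(1) by (simp_all add: sum.remove)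
    moreover have "\<forall>x\<in>V - {v}. 0 \<le> \<pi> x" using \<pi> by blast
    ultimately have "p \<in> convex hull (V - {v})" using V(1) by (subst convex_hull_finite) auto
    moreover have "(norm (p - q))\<^sup>2 \<le> (norm (w - q))\<^sup>2"
      using expand[of w] dot[OF w] by (smt (verit) zero_le_power2)
    ultimately show ?thesis using v(1) w2 by (smt (verit))
  next
    case False
    then have pos: "\<pi> v > 0" if "v \<in> V" for v using \<pi>(1)[OF that] that by force
    \<comment> \<open>A sum of nonpositive terms with positive weights vanishes, so every term
      does.\<close>
    have "(\<Sum>v\<in>V. \<pi> v * ((q - p) \<bullet> (v - p))) = (q - p) \<bullet> ((\<Sum>v\<in>V. \<pi> v *\<^sub>R v) - sum \<pi> V *\<^sub>R p)"
      by (simp add: inner_diff_right inner_sum_right right_diff_distrib sum_subtractf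
          sum_distrib_right)
    also have "\<dots> = 0" using \<pi> by simp
    finally have "(\<Sum>v\<in>V. - (\<pi> v * ((q - p) \<bullet> (v - p)))) = 0" by (simp add: sum_negf)
    moreover have "0 \<le> - (\<pi> v * ((q - p) \<bullet> (v - p)))" if "v \<in> V" for v
      using dot[of v] pos[OF that] that by (simp add: hull_inc mult_le_0_iff)
    ultimately have "\<forall>v\<in>V. - (\<pi> v * ((q - p) \<bullet> (v - p))) = 0"
      using V(1) by (subst (asm) sum_nonneg_eq_0_iff) auto
    then have orthV: "(q - p) \<bullet> v = (q - p) \<bullet> p" if "v \<in> V" for v
      using pos that by (fastforce simp: inner_diff_right)
    have orth: "(q - p) \<bullet> (x - p) = 0" if x: "x \<in> ?H" for x
    proof -
      have "convex {x. (q - p) \<bullet> x = (q - p) \<bullet> p}" by (rule convex_hyperplane)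
      then have "?H \<subseteq> {x. (q - p) \<bullet> x = (q - p) \<bullet> p}" by (intro hull_minimal) (auto simp: orthV)
      then show ?thesis using x by (auto simp: inner_diff_right)
    qed
    obtain v w' where vw: "v \<in> V" "w' \<in> convex hull (V - {v})"
        "(norm (w' - p))\<^sup>2 \<le> (norm (w - p))\<^sup>2 + (1 - (norm w)\<^sup>2) / (real m)\<^sup>2"
      using affine_independent_ball_near_facet[OF V w p] by blast
    have "w' \<in> ?H" using vw(2) hull_mono[of "V - {v}" V convex] by blast
    then show ?thesis using vw expand[of w] expand[of w'] orth[OF w] orth[of w'] by force
  qed
qed

lemma unit_ball_hull_step:
  fixes u :: "'i \<Rightarrow> 'a::euclidean_space"
  assumes I: "finite I" "card I = m + 1" "m \<ge> 1" and u: "u ` I \<subseteq> cball 0 1"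
    and w: "w \<in> convex hull (u ` I)"
  shows "\<exists>i\<in>I. \<exists>w'\<in>convex hull (u ` (I - {i})).
    (norm (w' - q))\<^sup>2 \<le> (norm (w - q))\<^sup>2 + (1 - (norm w)\<^sup>2) / (real m)\<^sup>2"
proof (cases "\<exists>i\<in>I. w \<in> convex hull (u ` (I - {i}))")
  case True
  have "norm w \<le> 1"
    using w u hull_minimal[of "u ` I" "cball 0 1" convex] by (auto simp: subset_iff)
  then have "(1 - (norm w)\<^sup>2) / (real m)\<^sup>2 \<ge> 0" by (simp add: power_le_one)
  then show ?thesis using True by force
next
  case False
  have inj: "inj_on u I"
  proof (rule inj_onI, rule ccontr)
    fix i j assume ij: "i \<in> I" "j \<in> I" "u i = u j" "i \<noteq> j"
    then have "u ` (I - {i}) = u ` I" by (auto simp: image_iff)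
    then show False using False w ij by metis
  qed
  have indep: "\<not> affine_dependent (u ` I)"
  proof
    assume "affine_dependent (u ` I)"
    then have "aff_dim (u ` I) < int (card (u ` I)) - 1"
      using affine_independent_iff_card[of "u ` I"] aff_dim_le_card[of "u ` I"] I(1) by force
    moreover obtain S where S: "S \<subseteq> u ` I" "int (card S) \<le> aff_dim (u ` I) + 1" "w \<in> convex hull S"
      using w by (subst (asm) caratheodory_aff_dim) auto
    ultimately have "S \<noteq> u ` I" by auto
    then obtain i where i: "i \<in> I" "u i \<notin> S" using S(1) by blast
    then have "S \<subseteq> u ` (I - {i})" using S(1) by auto
    then show False using False i S(3) hull_mono[of S "u ` (I - {i})" convex] by blast
  qed
  have c: "card (u ` I) = m + 1" using inj I by (simp add: card_image)
  have "finite (u ` I)" using I by simp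
  from affine_independent_ball_step[OF this indep c I(3) u w, of q]
  obtain i w' where i: "i \<in> I" "w' \<in> convex hull (u ` I - {u i})"
    "(norm (w' - q))\<^sup>2 \<le> (norm (w - q))\<^sup>2 + (1 - (norm w)\<^sup>2) / (real m)\<^sup>2"
    by blast
  have "u ` I - {u i} \<subseteq> u ` (I - {i})" by blast
  then have "w' \<in> convex hull (u ` (I - {i}))" using i(2) hull_mono by blast
  then show ?thesis using i by blast
qed

text \<open>Induction on the number of points. The coefficient of
  \<open>1 - (norm w)\<^sup>2\<close> is 0 for \<open>n = k\<close>, and for \<open>w = 0\<close>
  the added term is the square of the bound in the theorem.\<close>

lemma unit_ball_hull_near_face:
  fixes u :: "'i \<Rightarrow> 'a::euclidean_space"
  assumes k: "k \<ge> 2" "k \<le> n"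
    and I: "finite I" "card I = n" and u: "u ` I \<subseteq> cball 0 1"
    and w: "w \<in> convex hull (u ` I)"
  shows "\<exists>J\<subseteq>I. card J = k \<and> (\<exists>w'\<in>convex hull (u ` J). (norm (w' - p))\<^sup>2
    \<le> (norm (w - p))\<^sup>2 + (1 - ((real k - 1) * n) / (k * (real n - 1))) * (1 - (norm w)\<^sup>2))"
  using k(2) I u w
proof (induction n arbitrary: I w rule: dec_induct)
  case base
  then show ?case using k(1) by (intro exI[of _ I] conjI bexI[of _ w]) auto
next
  case (step m)
  define A where "A = ((real k - 1) * m) / (k * (real m - 1))"
  have m: "real m > 1" "real k > 1" using k step.hyps by auto
  have A: "A > 0" using m by (simp add: A_def)
  \<comment> \<open>This recursion fixes the form of the coefficient: it is the telescoped product
    of the factors \<open>1 - 1 / m\<^sup>2\<close>.\<close>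
  have A': "((real k - 1) * Suc m) / (k * (real (Suc m) - 1)) = A * (1 - 1 / (real m)\<^sup>2)"
    using m by (simp add: A_def divide_simps) (simp add: algebra_simps power2_eq_square)
  \<comment> \<open>The induction hypothesis bounds the result by a quadratic function of \<open>w'\<close> minimal at \<open>p / A\<close>,
    so that is the point the facet has to be close to.\<close>
  define q where "q = (1 / A) *\<^sub>R p"
  have p: "p = A *\<^sub>R q" using A by (simp add: q_def)
  have complete_square: "(norm (x - p))\<^sup>2 + (1 - A) * (1 - (norm x)\<^sup>2)
      = A * (norm (x - q))\<^sup>2 + (A\<^sup>2 - A) * (norm q)\<^sup>2 + (1 - A)" for x
    unfolding power2_norm_eq_inner p
    by (simp add: inner_diff inner_commute algebra_simps power2_eq_square)
  have "m \<ge> 1" "card I = m + 1" using m step.prems by auto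
  from unit_ball_hull_step[OF step.prems(1) this(2,1) step.prems(3,4), of q]
  obtain i w' where i: "i \<in> I" "w' \<in> convex hull (u ` (I - {i}))"
    and w': "(norm (w' - q))\<^sup>2 \<le> (norm (w - q))\<^sup>2 + (1 - (norm w)\<^sup>2) / (real m)\<^sup>2"
    by blast
  have "finite (I - {i})" "card (I - {i}) = m" "u ` (I - {i}) \<subseteq> cball 0 1"
    using step.prems i by auto
  from step.IH[OF this i(2)] obtain J w'' where J: "J \<subseteq> I - {i}" "card J = k" "w'' \<in> convex hull (u ` J)"
    and w'': "(norm (w'' - p))\<^sup>2 \<le> (norm (w' - p))\<^sup>2 + (1 - A) * (1 - (norm w')\<^sup>2)"
    unfolding A_def by blast
  note w''
  also have "(norm (w' - p))\<^sup>2 + (1 - A) * (1 - (norm w')\<^sup>2)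
      \<le> A * ((norm (w - q))\<^sup>2 + (1 - (norm w)\<^sup>2) / (real m)\<^sup>2) + (A\<^sup>2 - A) * (norm q)\<^sup>2 + (1 - A)"
    unfolding complete_square using w' A by simp
  also have "\<dots> = (norm (w - p))\<^sup>2 + (1 - A) * (1 - (norm w)\<^sup>2) + A * (1 / (real m)\<^sup>2) * (1 - (norm w)\<^sup>2)"
    unfolding complete_square by (simp add: distrib_left)
  also have "\<dots> = (norm (w - p))\<^sup>2 + (1 - A * (1 - 1 / (real m)\<^sup>2)) * (1 - (norm w)\<^sup>2)"
    by (simp only: left_diff_distrib right_diff_distrib mult_1_left mult_1_right)
  finally show ?case using J unfolding A' by blast
qed

section \<open>Minimising the largest distance to finitely many compact convex sets\<close>

text \<open>First-order optimality: if 0 were outside the hull of the unit vectors from the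
  minimiser towards the farthest sets, a direction at an acute angle to all of them would shorten
  all these distances.\<close>

lemma minimax_distance_optimality:
  fixes C :: "'i \<Rightarrow> 'a::euclidean_space set"
  assumes I: "finite I" "I \<noteq> {}"
    and C: "\<And>i. i \<in> I \<Longrightarrow> compact (C i)" "\<And>i. i \<in> I \<Longrightarrow> convex (C i)" "\<And>i. i \<in> I \<Longrightarrow> C i \<noteq> {}"
  shows "\<exists>q r. (\<forall>i\<in>I. infdist q (C i) \<le> r) \<and>
    (r > 0 \<longrightarrow> (\<exists>A u. A \<subseteq> I \<and> (\<forall>i\<in>A. norm (u i) = 1) \<and> 0 \<in> convex hull (u ` A) \<and>
       (\<forall>i\<in>A. \<forall>x\<in>C i. r \<le> u i \<bullet> (x - q))))"
proof -
  define f where "f = (\<lambda>q. Max ((\<lambda>i. infdist q (C i)) ` I))"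
  have f_ge: "infdist q (C i) \<le> f q" if "i \<in> I" for q i
    unfolding f_def using I that by (intro Max_ge) auto
  have f_less: "f q < t" if "\<And>i. i \<in> I \<Longrightarrow> infdist q (C i) < t" for q t
    unfolding f_def using I that by (subst Max_less_iff) auto
  have f_le: "f q \<le> t" if "\<And>i. i \<in> I \<Longrightarrow> infdist q (C i) \<le> t" for q t
    unfolding f_def using I that by (subst Max_le_iff) auto
  have lipschitz: "f x \<le> f y + dist x y" for x y
  proof (rule f_le)
    fix i assume "i \<in> I"
    then show "infdist x (C i) \<le> f y + dist x y"
      using infdist_triangle[of x "C i" y] f_ge[of i y] by linarith
  qed
  have cont: "continuous_on S f" for S
  proof (rule continuous_onI)
    fix e :: real assume "e > 0"
    show "\<exists>d>0. \<forall>x'\<in>S. dist x' y < d \<longrightarrow> dist (f x') (f y) \<le> e" for y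
    proof (intro exI[of _ e] conjI ballI impI \<open>e > 0\<close>)
      fix x' assume "dist x' y < e"
      then show "dist (f x') (f y) \<le> e"
        using lipschitz[of x' y] lipschitz[of y x'] by (auto simp: dist_real_def dist_commute)
    qed
  qed
  have "bounded (\<Union>i\<in>I. C i)" using I C compact_imp_bounded by (intro bounded_UN) auto
  then obtain B where B: "B > 0" "\<And>i x. i \<in> I \<Longrightarrow> x \<in> C i \<Longrightarrow> norm x \<le> B"
    unfolding bounded_pos by blast
  \<comment> \<open>The value at 0 is at most \<open>B\<close>, and outside this ball values are at
    least \<open>B\<close>, so the minimum over the ball is global.\<close>
  obtain q where q: "q \<in> cball 0 (2 * B)" "\<And>y. y \<in> cball 0 (2 * B) \<Longrightarrow> f q \<le> f y"
    using continuous_attains_inf[OF compact_cball _ cont, of 0 "2 * B"] B(1) by auto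
  have f0: "f 0 \<le> B"
  proof (rule f_le)
    fix i assume i: "i \<in> I"
    then obtain x where "x \<in> C i" using C by blast
    then show "infdist 0 (C i) \<le> B" using infdist_le[of x "C i" 0] B(2)[OF i] by force
  qed
  have minimal: "f q \<le> f y" for y
  proof (cases "y \<in> cball 0 (2 * B)")
    case False
    obtain i where i: "i \<in> I" using I by blast
    obtain x where x: "x \<in> C i" "infdist y (C i) = dist y x"
      using infdist_attains_inf[of "C i" y] C[OF i] compact_imp_closed by blast
    have "norm y \<le> dist y x + norm x" using norm_triangle_ineq2[of y x] by (simp add: dist_norm)
    then have "B \<le> f y" using f_ge[OF i, of y] x B(2)[OF i x(1)] False by auto
    then show ?thesis using f0 q(2)[of 0] B by simp
  qed (rule q(2))
  define r where "r = f q"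
  have "\<exists>A u. A \<subseteq> I \<and> (\<forall>i\<in>A. norm (u i) = 1) \<and> 0 \<in> convex hull (u ` A) \<and>
       (\<forall>i\<in>A. \<forall>x\<in>C i. r \<le> u i \<bullet> (x - q))" if r: "r > 0"
  proof -
    have "\<forall>i\<in>I. \<exists>y\<in>C i. infdist q (C i) = dist q y"
      using infdist_attains_inf C compact_imp_closed by metis
    then obtain y where y: "\<And>i. i \<in> I \<Longrightarrow> y i \<in> C i" "\<And>i. i \<in> I \<Longrightarrow> infdist q (C i) = dist q (y i)"
      by metis
    define A where "A = {i \<in> I. infdist q (C i) = r}"
    define u where "u = (\<lambda>i. (1 / r) *\<^sub>R (y i - q))"
    have AI: "A \<subseteq> I" by (auto simp: A_def)
    have dA: "dist q (y i) = r" if "i \<in> A" for i using that y by (auto simp: A_def)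
    have yu: "y i - q = r *\<^sub>R u i" for i using r by (simp add: u_def)
    have nu: "norm (u i) = 1" if "i \<in> A" for i
      using dA[OF that] r by (simp add: u_def dist_norm norm_minus_commute)
    \<comment> \<open>The set \<open>C i\<close> lies beyond the hyperplane through its nearest
      point \<open>y i\<close> orthogonal to \<open>u i\<close>.\<close>
    have sep: "r \<le> u i \<bullet> (x - q)" if i: "i \<in> A" and x: "x \<in> C i" for i x
    proof -
      have iI: "i \<in> I" using i AI by blast
      have "(q - y i) \<bullet> (x - y i) \<le> 0"
        using C[OF iI] x y[OF iI] infdist_le[of _ "C i" q]
        by (intro any_closest_point_dot[of "C i"]) (auto simp: compact_imp_closed)
      moreover have "q - y i = - (r *\<^sub>R u i)" using yu[of i] by (simp add: algebra_simps)
      ultimately have "0 \<le> r * (u i \<bullet> (x - y i))" by simp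
      then have "0 \<le> u i \<bullet> (x - y i)" using r by (simp add: zero_le_mult_iff)
      moreover have "u i \<bullet> (y i - q) = r" using nu[OF i] unfolding yu by (simp add: dot_square_norm)
      moreover have "x - q = (x - y i) + (y i - q)" by simp
      ultimately show ?thesis by (metis add_increasing inner_add_right order_refl)
    qed
    have "0 \<in> convex hull (u ` A)"
    proof (rule ccontr)
      assume no: "0 \<notin> convex hull (u ` A)"
      have "finite A" using I AI finite_subset by blast
      then have "closed (convex hull (u ` A))"
        by (simp add: compact_imp_closed finite_imp_compact_convex_hull)
      from separating_hyperplane_closed_0[OF convex_convex_hull this no]
      obtain v t where v: "0 < t" "\<And>x. x \<in> convex hull (u ` A) \<Longrightarrow> v \<bullet> x > t" by blast
      have vu: "v \<bullet> u i > 0" if "i \<in> A" for i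
        using v(2)[of "u i"] v(1) that by (force intro: hull_inc)
      \<comment> \<open>Sets outside \<open>A\<close> have slack and continuity suffices. For
        \<open>i\<close> in \<open>A\<close>, the squared distance to the fixed point
        \<open>y i\<close> changes by
        \<open>e\<^sup>2 * (v \<bullet> v) - 2 * e * r * (v \<bullet> u i)\<close>, negative for
        small \<open>e\<close>.\<close>
      have "\<forall>\<^sub>F e in at_right (0::real). infdist (q + e *\<^sub>R v) (C i) < r" if i: "i \<in> I" for i
      proof (cases "i \<in> A")
        case False
        then have lt: "infdist q (C i) < r" using f_ge[OF i, of q] i by (auto simp: A_def r_def)
        have "((\<lambda>e. infdist (q + e *\<^sub>R v) (C i)) \<longlongrightarrow> infdist (q + 0 *\<^sub>R v) (C i)) (at_right 0)"
          by (intro tendsto_intros)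
        then show ?thesis using order_tendstoD(2)[of _ "infdist q (C i)" _ r] lt by simp
      next
        case True
        let ?c = "2 * r * (v \<bullet> u i)"
        have "((\<lambda>e. e * (v \<bullet> v)) \<longlongrightarrow> 0 * (v \<bullet> v)) (at_right (0::real))" by (intro tendsto_intros)
        moreover have "0 * (v \<bullet> v) < ?c" using vu[OF True] r by simp
        ultimately have "\<forall>\<^sub>F e in at_right (0::real). e * (v \<bullet> v) < ?c" by (rule order_tendstoD(2))
        moreover have "\<forall>\<^sub>F e in at_right (0::real). e > 0" by (rule eventually_at_right_less)
        ultimately show ?thesis
        proof eventually_elim
          case (elim e)
          have "q + e *\<^sub>R v - y i = e *\<^sub>R v - r *\<^sub>R u i" using yu[of i] by (simp add: algebra_simps)
          then have "(dist (q + e *\<^sub>R v) (y i))\<^sup>2 = e * (e * (v \<bullet> v)) - e * ?c + r\<^sup>2 * (u i \<bullet> u i)"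
            unfolding dist_norm power2_norm_eq_inner
            by (simp only:) (simp add: inner_diff inner_commute algebra_simps power2_eq_square)
          also have "\<dots> < r\<^sup>2" using elim nu[OF True] by (simp add: dot_square_norm)
          finally have "dist (q + e *\<^sub>R v) (y i) < r" using r by (simp add: power_less_imp_less_base)
          then show ?case using infdist_le[OF y(1)[OF i], of "q + e *\<^sub>R v"] by simp
        qed
      qed
      then have "\<forall>\<^sub>F e in at_right (0::real). \<forall>i\<in>I. infdist (q + e *\<^sub>R v) (C i) < r"
        using I by (simp add: eventually_ball_finite)
      then obtain e :: real where "\<forall>i\<in>I. infdist (q + e *\<^sub>R v) (C i) < r"
        using eventually_happens trivial_limit_at_right_real by blast
      then show False using f_less[of "q + e *\<^sub>R v" r] minimal[of "q + e *\<^sub>R v"] by (simp add: r_def)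
    qed
    then show ?thesis using AI nu sep by blast
  qed
  moreover have "\<forall>i\<in>I. infdist q (C i) \<le> r" using f_ge[of _ q] by (simp add: r_def)
  ultimately show ?thesis by blast
qed

section \<open>From the face estimate to the distance bound\<close>

theorem theorem5p1:
  fixes K :: "nat \<Rightarrow> 'a::euclidean_space set" and n k :: nat and b :: 'a
  assumes "n \<ge> 2"
    and "\<And>i. i \<in> {1..n} \<Longrightarrow> convex (K i)"
    and "k \<in> {1..n}"
    and "\<And>J. J \<subseteq> {1..n} \<Longrightarrow> card J = k \<Longrightarrow> cball b 1 \<inter> (\<Inter>j\<in>J. K j) \<noteq> {}"
  shows "\<exists>q::'a. \<forall>i\<in>{1..n}.
           infdist q (K i) \<le> sqrt ((real n - real k) / (real k * (real n - 1)))"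
proof (cases "k = 1")
  case True
  \<comment> \<open>For \<open>k = 1\<close> the bound equals 1 and \<open>b\<close> itself works;
    the face estimate requires \<open>k \<ge> 2\<close>.\<close>
  have "infdist b (K i) \<le> 1" if i: "i \<in> {1..n}" for i
  proof -
    obtain x where "x \<in> cball b 1" "x \<in> K i" using assms(4)[of "{i}"] i True by auto
    then show ?thesis using infdist_le[of x "K i" b] by auto
  qed
  then show ?thesis using True assms(1) by (intro exI[of _ b]) auto
next
  case False
  then have k: "k \<ge> 2" "k \<le> n" using assms(3) by auto
  define \<rho> where "\<rho> = sqrt ((real n - real k) / (real k * (real n - 1)))"
  have \<rho>: "\<rho> \<ge> 0" "\<rho>\<^sup>2 = (real n - real k) / (real k * (real n - 1))"
    using k by (auto simp: \<rho>_def)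
  define \<J> where "\<J> = {J. J \<subseteq> {1..n} \<and> card J = k}"
  have "\<forall>J\<in>\<J>. \<exists>x. x \<in> cball b 1 \<inter> (\<Inter>j\<in>J. K j)"
    using assms(4) unfolding \<J>_def by blast
  then obtain x where x: "\<And>J. J \<in> \<J> \<Longrightarrow> x J \<in> cball b 1 \<inter> (\<Inter>j\<in>J. K j)" by metis
  \<comment> \<open>Hulls of finitely many points are compact, which the sets \<open>K i\<close>
    need not be.\<close>
  define C where "C = (\<lambda>i. convex hull (x ` {J \<in> \<J>. i \<in> J}))"
  have fin: "finite \<J>" by (rule finite_subset[of _ "Pow {1..n}"]) (auto simp: \<J>_def)
  have superset: "\<exists>J\<in>\<J>. S \<subseteq> J" if "S \<subseteq> {1..n}" "card S \<le> k" for S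
    using exists_subset_between[of S k "{1..n}"] that k by (auto simp: \<J>_def)
  have Cne: "C i \<noteq> {}" if "i \<in> {1..n}" for i
    using superset[of "{i}"] that k by (auto simp: C_def)
  have CK: "C i \<subseteq> K i" if "i \<in> {1..n}" for i
    unfolding C_def using assms(2)[OF that] x by (intro hull_minimal) auto
  have "compact (C i)" if "i \<in> {1..n}" for i
    unfolding C_def using fin by (intro finite_imp_compact_convex_hull) auto
  moreover have "convex (C i)" for i unfolding C_def by (rule convex_convex_hull)
  ultimately obtain q r where q: "\<And>i. i \<in> {1..n} \<Longrightarrow> infdist q (C i) \<le> r"
    and opt: "r > 0 \<Longrightarrow> \<exists>A u. A \<subseteq> {1..n} \<and> (\<forall>i\<in>A. norm (u i) = 1) \<and> 0 \<in> convex hull (u ` A) \<and>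
       (\<forall>i\<in>A. \<forall>x\<in>C i. r \<le> u i \<bullet> (x - q))"
    using minimax_distance_optimality[of "{1..n}" C] Cne assms(1) by fastforce
  have "r \<le> \<rho>"
  proof (cases "r > 0")
    case True
    from opt[OF this] obtain A u where A: "A \<subseteq> {1..n}" "\<And>i. i \<in> A \<Longrightarrow> norm (u i) = 1"
        "0 \<in> convex hull (u ` A)" "\<And>i x. i \<in> A \<Longrightarrow> x \<in> C i \<Longrightarrow> r \<le> u i \<bullet> (x - q)"
      by blast
    have finA: "finite A" using A(1) finite_subset by blast
    define c where "c = b - q"
    \<comment> \<open>This is \<open>(norm (w - p))\<^sup>2 \<le> (norm p)\<^sup>2 +
      \<rho>\<^sup>2\<close> for \<open>p = - (\<rho> *\<^sub>R c)\<close>, expanded.\<close>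
    have "\<exists>J\<in>\<J>. \<exists>w\<in>convex hull (u ` (J \<inter> A)). (norm w)\<^sup>2 + 2 * \<rho> * (w \<bullet> c) \<le> \<rho>\<^sup>2"
    proof (cases "k \<le> card A")
      case True
      define N where "N = card A"
      have N: "k \<le> N" "N \<le> n" using True card_mono[OF _ A(1)] by (auto simp: N_def)
      have "u ` A \<subseteq> cball 0 1" using A(2) by auto
      from unit_ball_hull_near_face[OF k(1) N(1) finA _ this A(3), of "- (\<rho> *\<^sub>R c)"]
      obtain J w where J: "J \<subseteq> A" "card J = k" "w \<in> convex hull (u ` J)"
        and "(norm (w + \<rho> *\<^sub>R c))\<^sup>2 \<le> (norm (\<rho> *\<^sub>R c))\<^sup>2 + (1 - ((real k - 1) * N) / (k * (real N - 1)))"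
        by (auto simp: N_def)
      moreover have "1 - ((real k - 1) * N) / (k * (real N - 1)) \<le> \<rho>\<^sup>2"
      proof -
        \<comment> \<open>In this form the bound visibly grows with \<open>M\<close>, so the number
          \<open>N\<close> of active sets can be replaced by \<open>n\<close>.\<close>
        have *: "1 - ((real k - 1) * M) / (k * (real M - 1)) = (1 - (real k - 1) / (real M - 1)) / k"
          if "M \<ge> 2" for M :: nat
          using that k by (simp add: divide_simps) (simp add: algebra_simps)
        have "(1 - (real k - 1) / (real N - 1)) / k \<le> (1 - (real k - 1) / (real n - 1)) / k"
          using N k by (intro divide_right_mono diff_left_mono divide_left_mono) auto
        also have "\<dots> = \<rho>\<^sup>2" using k unfolding \<rho>(2) by (simp add: divide_simps)
        finally show ?thesis using *[of N] N k by simp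
      qed
      moreover have "(norm (w + \<rho> *\<^sub>R c))\<^sup>2 = (norm w)\<^sup>2 + 2 * \<rho> * (w \<bullet> c) + (norm (\<rho> *\<^sub>R c))\<^sup>2"
        unfolding power2_norm_eq_inner by (simp add: inner_add inner_commute)
      ultimately have "(norm w)\<^sup>2 + 2 * \<rho> * (w \<bullet> c) \<le> \<rho>\<^sup>2" by linarith
      moreover have "J \<in> \<J>" "J \<inter> A = J" using J A by (auto simp: \<J>_def)
      ultimately show ?thesis using J(3) by metis
    next
      \<comment> \<open>With fewer than \<open>k\<close> active sets, one \<open>J\<close> contains
        them all and \<open>w = 0\<close> works.\<close>
      case False
      then obtain J where J: "J \<in> \<J>" "A \<subseteq> J" using superset[OF A(1)] by auto
      then have "J \<inter> A = A" by blast
      then show ?thesis using A(3) J by (intro bexI[of _ J] bexI[of _ 0]) auto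
    qed
    then obtain J w where J: "J \<in> \<J>" "w \<in> convex hull (u ` (J \<inter> A))"
      and w: "(norm w)\<^sup>2 + 2 * \<rho> * (w \<bullet> c) \<le> \<rho>\<^sup>2" by blast
    \<comment> \<open>The one point \<open>x J\<close> lies in \<open>C i\<close> for every
      \<open>i\<close> in \<open>J\<close>, so the inequalities for the \<open>u i\<close> share it
      and pass to convex combinations.\<close>
    have "convex hull (u ` (J \<inter> A)) \<subseteq> {y. (x J - q) \<bullet> y \<ge> r}"
    proof (rule hull_minimal)
      show "u ` (J \<inter> A) \<subseteq> {y. (x J - q) \<bullet> y \<ge> r}"
      proof
        fix y assume "y \<in> u ` (J \<inter> A)"
        then obtain i where i: "i \<in> J" "i \<in> A" "y = u i" by blast
        have "x J \<in> C i" unfolding C_def using i J(1) by (intro hull_inc) auto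
        then show "y \<in> {y. (x J - q) \<bullet> y \<ge> r}" using A(4) i by (simp add: inner_commute)
      qed
    qed (rule convex_halfspace_ge)
    then have "r \<le> w \<bullet> (x J - q)" using J(2) by (auto simp: inner_commute)
    also have "\<dots> = w \<bullet> (x J - b) + w \<bullet> c" by (simp add: c_def inner_diff_right)
    also have "w \<bullet> (x J - b) \<le> norm w * 1"
      using x[OF J(1)] by (intro order_trans[OF norm_cauchy_schwarz] mult_left_mono)
        (auto simp: dist_norm norm_minus_commute)
    finally have r: "r \<le> norm w + w \<bullet> c" by simp
    show ?thesis
    \<comment> \<open>The final division by \<open>\<rho>\<close> excludes 0; there the condition on
      \<open>w\<close> forces \<open>w = 0\<close>, hence \<open>r \<le> 0\<close>.\<close>
    proof (cases "\<rho> = 0")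
      case True
      then show ?thesis using w r by simp
    next
      case False
      then have "\<rho> > 0" using \<rho>(1) by simp
      have "2 * \<rho> * r \<le> 2 * \<rho> * norm w + 2 * \<rho> * (w \<bullet> c)"
        unfolding distrib_left[symmetric] using r \<rho>(1) by (intro mult_left_mono) auto
      also have "2 * \<rho> * norm w \<le> (norm w)\<^sup>2 + \<rho>\<^sup>2"
        using sum_squares_bound[of \<rho> "norm w"] by simp
      finally have "2 * \<rho> * r \<le> 2 * \<rho> * \<rho>" using w by (simp add: power2_eq_square)
      then show ?thesis using \<open>\<rho> > 0\<close> by simp
    qed
  qed (use \<rho>(1) in simp)
  then have "infdist q (K i) \<le> \<rho>" if "i \<in> {1..n}" for i
    using infdist_mono[OF CK[OF that] Cne[OF that], of q] q[OF that] by simp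
  then show ?thesis unfolding \<rho>_def by blast
qed

end
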